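(* Let $n\ge 5$ be an integer. If $n\equiv 0,1,2,3,4,6,7,9\pmod{10}$, then $\gamma_I(P(n,2))=\gamma_{r2}(P(n,2))$. If $n\equiv 5,8\pmod{10}$, then $\gamma_I(P(n,2))=\gamma_{r2}(P(n,2))-1$.
   Context: $P(n,k)$ (with $n\ge 3$, $1\le k<n/2$) denotes the generalized Petersen graph: the 3-regular simple graph on the $2n$ vertices $v_0,v_1,\dots,v_{2n-1}$ (subscripts read modulo $2n$) with edges $v_{2i}v_{2i+2}$, $v_{2i}v_{2i+1}$ and $v_{2i+1}v_{2i+1+2k}$ for $0\le i\le n-1$. For a graph $G=(V,E)$, an Italian dominating function (IDF) of $G$ is a function $f:V\to\{0,1,2\}$ such that every $v\in V$ with $f(v)=0$ satisfies $\sum_{u\in N(v)}f(u)\ge 2$, where $N(v)$ is the open neighborhood of $v$. Its weight is $w(f)=\sum_{v\in V}f(v)$, and the Italian domination number is $\gamma_I(G)=\min_f w(f)$ over all IDFs $f$ of $G$. A 2-rainbow dominating function of $G$ is a function $g:V\to\{\emptyset,\{1\},\{2\},\{1,2\}\}$ such that every $v\in V$ with $g(v)=\emptyset$ satisfies $\bigcup_{u\in N(v)}g(u)=\{1,2\}$; its weight is $\sum_{v\in V}|g(v)|$, and the 2-rainbow domination number $\gamma_{r2}(G)$ is the minimum weight of a 2-rainbow dominating function of $G$. *)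

theory Defs
  imports "Graph_Theory.Pair_Digraph"
begin

text \<open>A simple undirected graph is a \<^locale>\<open>pair_graph\<close>: every edge is represented by
  the two arcs of opposite direction.\<close>

definition petersen :: "nat \<Rightarrow> nat \<Rightarrow> nat pair_pre_digraph" where
  "petersen n k =
    (let E = (\<Union>i<n. {(2 * i, (2 * i + 2) mod (2 * n)),
                     (2 * i, 2 * i + 1),
                     (2 * i + 1, (2 * i + 1 + 2 * k) mod (2 * n))})
     in \<lparr> pverts = {..<2 * n}, parcs = E \<union> E\<inverse> \<rparr>)"

definition nbhd :: "'a pair_pre_digraph \<Rightarrow> 'a \<Rightarrow> 'a set" where
  "nbhd G v = {u. (v, u) \<in> parcs G}"

text \<open>Only the values on the vertex set matter below: the functions in question are total
  in the logic, but are constrained and summed over \<^term>\<open>pverts G\<close> only.\<close>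

definition italian_dominating :: "'a pair_pre_digraph \<Rightarrow> ('a \<Rightarrow> nat) \<Rightarrow> bool" where
  "italian_dominating G f \<longleftrightarrow>
     (\<forall>v \<in> pverts G. f v \<in> {0, 1, 2}) \<and>
     (\<forall>v \<in> pverts G. f v = 0 \<longrightarrow> (\<Sum>u \<in> nbhd G v. f u) \<ge> 2)"

definition italian_domination_number :: "'a pair_pre_digraph \<Rightarrow> nat" where
  "italian_domination_number G =
     (LEAST w. \<exists>f. italian_dominating G f \<and> w = (\<Sum>v \<in> pverts G. f v))"

definition rainbow2_dominating :: "'a pair_pre_digraph \<Rightarrow> ('a \<Rightarrow> nat set) \<Rightarrow> bool" where
  "rainbow2_dominating G g \<longleftrightarrow>
     (\<forall>v \<in> pverts G. g v \<in> {{}, {1}, {2}, {1, 2}}) \<and>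
     (\<forall>v \<in> pverts G. g v = {} \<longrightarrow> (\<Union>u \<in> nbhd G v. g u) = {1, 2})"

definition rainbow2_domination_number :: "'a pair_pre_digraph \<Rightarrow> nat" where
  "rainbow2_domination_number G =
     (LEAST w. \<exists>g. rainbow2_dominating G g \<and> w = (\<Sum>v \<in> pverts G. card (g v)))"

lemma pair_graph_petersen:
  assumes "n \<ge> 3" "1 \<le> k" "2 * k < n"
  shows "pair_graph (petersen n k)"
proof -
  have ne1: "(2 * i + 2) mod (2 * n) \<noteq> 2 * i" if "i < n" for i
    using that assms by (cases "i + 1 = n") auto
  have ne2: "(2 * i + 1 + 2 * k) mod (2 * n) \<noteq> 2 * i + 1" if "i < n" for i
  proof (cases "i + k < n")
    case True
    then show ?thesis using assms by simp
  next
    case False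
    then have "(2 * i + 1 + 2 * k) mod (2 * n) = 2 * i + 1 + 2 * k - 2 * n"
      using that assms by (subst le_mod_geq) auto
    then show ?thesis using that assms False by linarith
  qed
  show ?thesis
  proof
    show "finite (pverts (petersen n k))" "finite (parcs (petersen n k))"
      by (auto simp: petersen_def Let_def)
    show "fst e \<in> pverts (petersen n k)" "snd e \<in> pverts (petersen n k)"
      if "e \<in> parcs (petersen n k)" for e
      using that assms by (auto simp: petersen_def Let_def)
    show "fst e \<noteq> snd e" if "e \<in> parcs (petersen n k)" for e
      using that ne1 ne2 by (auto simp: petersen_def Let_def) metis+
    show "symmetric (with_proj (petersen n k))"
      by (auto simp: symmetric_def petersen_def Let_def sym_def arcs_ends_conv)
  qed
qed

lemma italian_dominating_exists: "\<exists>f. italian_dominating G f"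
  by (rule exI[of _ "\<lambda>_. 1"]) (simp add: italian_dominating_def)

lemma rainbow2_dominating_exists: "\<exists>g. rainbow2_dominating G g"
  by (rule exI[of _ "\<lambda>_. {1}"]) (simp add: rainbow2_dominating_def)

end

theory Submission
  imports Defs
begin

text \<open>
  For a function \<open>f\<close> with values in \<open>{0, 1, 2}\<close> call \<open>E(v) = f(N(v)) + 2 f(v) - 2\<close> the excess
  of the vertex \<open>v\<close>. It is non-negative at every vertex exactly when \<open>f\<close> is Italian dominating, and
  since the graph is 3-regular on \<open>2n\<close> vertices, the total excess is \<open>e = 5 w(f) - 4 n\<close>. So both
  domination numbers are at least \<open>4n/5\<close>, and it remains to find the least total excess in the
  residue class of \<open>n\<close> modulo 5 that an Italian, respectively a 2-rainbow, dominating function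
  attains.

  Write the graph as a cyclic sequence of columns (outer value, inner value). A function with total
  excess at most 3 is extremely rigid. It contains the four columns \<open>10 01 01 10\<close>, called a block
  below (\<open>block_exists\<close>), and the next block starts either 5 columns later, after a separating column
  \<open>00\<close>, at no cost, or 3 columns later, so that the two blocks overlap in one column, at the cost of
  excess 3 (\<open>next_block\<close>). Both facts are finite statements about windows of at most 14 columns;
  they are established by an exhaustive search that abandons a window once its excess exceeds the
  bound. Running around the cycle once, excess 1 or 2 allows only steps of length 5, hence
  \<open>5\<close> divides \<open>n\<close> and then \<open>e\<close>, a contradiction: the total excess is never 1 or 2.

  The vertices of weight 1 of a 2-rainbow dominating function carry one of two hues, and a vertex
  of weight 0 with only two non-zero neighbours, both of weight 1, forces them to have different
  hues. This makes a step of length 5 exchange the hue at the start of the block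
  (\<open>long_block_swaps\<close>), while a step of length 3 that follows one of length 5 keeps it
  (\<open>short_block_keeps\<close>). Closing up around the cycle requires an even number of steps of length 5. Hence excess 0 is impossible for
  \<open>n\<close> congruent to 5 modulo 10 and excess 3 is impossible for \<open>n\<close> congruent to 8, which are the
  two classes where the numbers differ.

  For the matching upper bounds, explicit words of columns of length 5 to 14 that all start with the
  same block are prolonged by copies of one word of length 10 and weight 8.
\<close>

section \<open>The generalized Petersen graph as a cyclic sequence of columns\<close>

definition columns :: "nat \<Rightarrow> (nat \<Rightarrow> 'v) \<Rightarrow> nat \<Rightarrow> 'v \<times> 'v" where
  "columns n f i = (f (2 * (i mod n)), f (2 * (i mod n) + 1))"

text \<open>
  The predicate \<open>D v x y z\<close> is the local condition at a vertex of value \<open>v\<close> whose neighbours have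
  the values \<open>x\<close>, \<open>y\<close>, \<open>z\<close>. Of five consecutive columns, the condition is imposed on the inner
  vertex of the third and the outer vertex of the fourth: these are the two vertices whose last
  missing neighbour lies in the fifth column. When the window moves around the cycle, every vertex is
  treated exactly once.
\<close>
fun link :: "('v \<Rightarrow> 'v \<Rightarrow> 'v \<Rightarrow> 'v \<Rightarrow> bool) \<Rightarrow>
    'v \<times> 'v \<Rightarrow> 'v \<times> 'v \<Rightarrow> 'v \<times> 'v \<Rightarrow> 'v \<times> 'v \<Rightarrow> 'v \<times> 'v \<Rightarrow> bool" where
  "link D (pa, pb) (qa, qb) (ra, rb) (sa, sb) (ta, tb) \<longleftrightarrow>
     D sa ra ta sb \<and> D rb pb tb ra"

definition linked :: "('v \<Rightarrow> 'v \<Rightarrow> 'v \<Rightarrow> 'v \<Rightarrow> bool) \<Rightarrow> (nat \<Rightarrow> 'v \<times> 'v) \<Rightarrow> bool" where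
  "linked D c \<longleftrightarrow> (\<forall>i. link D (c i) (c (i + 1)) (c (i + 2)) (c (i + 3)) (c (i + 4)))"

definition italian_at :: "nat \<Rightarrow> nat \<Rightarrow> nat \<Rightarrow> nat \<Rightarrow> bool" where
  "italian_at v x y z \<longleftrightarrow> v \<le> 2 \<and> (v = 0 \<longrightarrow> 2 \<le> x + y + z)"

definition rainbow_at :: "nat set \<Rightarrow> nat set \<Rightarrow> nat set \<Rightarrow> nat set \<Rightarrow> bool" where
  "rainbow_at v x y z \<longleftrightarrow>
     v \<in> {{}, {1}, {2}, {1, 2}} \<and> (v = {} \<longrightarrow> x \<union> y \<union> z = {1, 2})"

lemma pverts_petersen [simp]: "pverts (petersen n k) = {..<2 * n}"
  by (simp add: petersen_def Let_def)

lemma add_mod_cancel: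
  fixes x y k n :: nat
  shows "(x + k) mod n = (y + k) mod n \<longleftrightarrow> x mod n = y mod n"
proof (induction k)
  case (Suc k)
  have "Suc u mod n = Suc v mod n \<longleftrightarrow> u mod n = v mod n" for u v
    by (auto simp: mod_Suc split: if_splits)
  with Suc show ?case by simp
qed simp

lemma mem_nbhd_petersen:
  "u \<in> nbhd (petersen n k) v \<longleftrightarrow>
     (\<exists>i<n. v = 2 * i \<and> (u = 2 * ((i + 1) mod n) \<or> u = 2 * i + 1) \<or>
            v = 2 * i + 1 \<and> (u = 2 * ((i + k) mod n) + 1 \<or> u = 2 * i) \<or>
            v = 2 * ((i + 1) mod n) \<and> u = 2 * i \<or>
            v = 2 * ((i + k) mod n) + 1 \<and> u = 2 * i + 1)"
proof -
  have outer: "(2 * i + 2) mod (2 * n) = 2 * ((i + 1) mod n)" for i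
    using mult_mod_right [of 2 "i + 1" n] by simp
  have inner: "(2 * i + 1 + 2 * k) mod (2 * n) = 2 * ((i + k) mod n) + 1" for i
  proof -
    have "Suc (2 * x) \<noteq> 2 * n" for x
      by presburger
    then have "Suc (2 * (i + k)) mod (2 * n) = Suc (2 * (i + k) mod (2 * n))"
      by (simp only: mod_Suc mult_mod_right [symmetric] if_False)
    then show ?thesis
      using mult_mod_right [of 2 "i + k" n] by simp
  qed
  show ?thesis
    unfolding nbhd_def petersen_def Let_def outer inner by auto
qed

lemma nbhd_outer:
  assumes "n \<ge> 1"
  shows "nbhd (petersen n k) (2 * ((i + 1) mod n)) =
    {2 * (i mod n), 2 * ((i + 2) mod n), 2 * ((i + 1) mod n) + 1}"
proof -
  have *: "(i + 1) mod n = (j + 1) mod n \<longleftrightarrow> j = i mod n" if "j < n" for j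
    using add_mod_cancel [of i 1 n j] that by auto
  have **: "((i + 1) mod n + 1) mod n = (i + 2) mod n"
    by (simp add: mod_simps)
  define m where "m = (i + 1) mod n"
  have m: "m < n" "i mod n < n" using assms by (simp_all add: m_def)
  have parity: "2 * x + 1 \<noteq> 2 * y" "2 * y \<noteq> 2 * x + 1" for x y :: nat by presburger+
  have "u \<in> nbhd (petersen n k) (2 * m) \<longleftrightarrow> u \<in> {2 * (i mod n), 2 * ((m + 1) mod n), 2 * m + 1}" for u
  proof -
    have "u \<in> nbhd (petersen n k) (2 * m) \<longleftrightarrow>
        (\<exists>j<n. m = j \<and> (u = 2 * ((j + 1) mod n) \<or> u = 2 * j + 1) \<or>
               m = (j + 1) mod n \<and> u = 2 * j)"
      unfolding mem_nbhd_petersen using parity by simp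
    also have "\<dots> \<longleftrightarrow>
        (\<exists>j<n. m = j \<and> (u = 2 * ((j + 1) mod n) \<or> u = 2 * j + 1) \<or> j = i mod n \<and> u = 2 * j)"
      by (intro ex_cong1 conj_cong refl) (simp only: m_def *)
    also have "\<dots> \<longleftrightarrow> u \<in> {2 * (i mod n), 2 * ((m + 1) mod n), 2 * m + 1}"
      using m by blast
    finally show ?thesis .
  qed
  then show ?thesis
    unfolding m_def ** by blast
qed

lemma nbhd_inner:
  assumes "n \<ge> 1"
  shows "nbhd (petersen n k) (2 * ((i + k) mod n) + 1) =
    {2 * (i mod n) + 1, 2 * ((i + 2 * k) mod n) + 1, 2 * ((i + k) mod n)}"
proof -
  have *: "(i + k) mod n = (j + k) mod n \<longleftrightarrow> j = i mod n" if "j < n" for j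
    using add_mod_cancel [of i k n j] that by auto
  have **: "((i + k) mod n + k) mod n = (i + 2 * k) mod n"
    by (simp add: mod_simps add.assoc mult_2)
  define m where "m = (i + k) mod n"
  have m: "m < n" "i mod n < n" using assms by (simp_all add: m_def)
  have parity: "2 * x + 1 \<noteq> 2 * y" "2 * y \<noteq> 2 * x + 1" for x y :: nat by presburger+
  have "u \<in> nbhd (petersen n k) (2 * m + 1) \<longleftrightarrow> u \<in> {2 * (i mod n) + 1, 2 * ((m + k) mod n) + 1, 2 * m}" for u
  proof -
    have "u \<in> nbhd (petersen n k) (2 * m + 1) \<longleftrightarrow>
        (\<exists>j<n. m = j \<and> (u = 2 * ((j + k) mod n) + 1 \<or> u = 2 * j) \<or>
               m = (j + k) mod n \<and> u = 2 * j + 1)"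
      unfolding mem_nbhd_petersen using parity by simp
    also have "\<dots> \<longleftrightarrow>
        (\<exists>j<n. m = j \<and> (u = 2 * ((j + k) mod n) + 1 \<or> u = 2 * j) \<or> j = i mod n \<and> u = 2 * j + 1)"
      by (intro ex_cong1 conj_cong refl) (simp only: m_def *)
    also have "\<dots> \<longleftrightarrow> u \<in> {2 * (i mod n) + 1, 2 * ((m + k) mod n) + 1, 2 * m}"
      using m by blast
    finally show ?thesis .
  qed
  then show ?thesis
    unfolding m_def ** by blast
qed

text \<open>
  The offsets allow the outer and the inner cycle to be traversed with a different lag, as required by
  windows in which the two checked vertices lie in different columns.
\<close>
lemma all_vertices_iff_columns:
  fixes P :: "nat \<Rightarrow> bool"
  assumes "n \<ge> 1"
  shows "(\<forall>v<2 * n. P v) \<longleftrightarrow> (\<forall>i. P (2 * ((i + k) mod n)) \<and> P (2 * ((i + l) mod n) + 1))"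
proof
  assume P: "\<forall>v<2 * n. P v"
  have "P (2 * m) \<and> P (2 * m + 1)" if "m < n" for m
    using P that by simp
  then show "\<forall>i. P (2 * ((i + k) mod n)) \<and> P (2 * ((i + l) mod n) + 1)"
    using assms by simp
next
  assume P: "\<forall>i. P (2 * ((i + k) mod n)) \<and> P (2 * ((i + l) mod n) + 1)"
  have shift: "\<exists>i. (i + k) mod n = m" if "m < n" for m k
  proof
    have "(n - 1) * k + k = n * k"
      using assms by (cases n) simp_all
    then show "(m + (n - 1) * k + k) mod n = m"
      using that by (simp add: add.assoc)
  qed
  show "\<forall>v<2 * n. P v"
  proof (intro allI impI)
    fix v assume "v < 2 * n"
    show "P v"
    proof (cases "even v")
      case True
      with \<open>v < 2 * n\<close> obtain m where "v = 2 * m" "m < n" by auto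
      then show ?thesis using P shift by metis
    next
      case False
      with \<open>v < 2 * n\<close> obtain m where "v = 2 * m + 1" "m < n" by (auto elim: oddE)
      then show ?thesis using P shift by metis
    qed
  qed
qed

lemma sum_over_vertices:
  fixes h :: "nat \<Rightarrow> nat"
  shows "(\<Sum>v<2 * n. h v) = (\<Sum>i<n. h (2 * i) + h (2 * i + 1))"
  by (induction n) simp_all

lemma distinct_columns:
  fixes d e n :: nat
  assumes "d < e" "e < d + n"
  shows "(i + d) mod n \<noteq> (i + e) mod n"
proof
  assume "(i + d) mod n = (i + e) mod n"
  then have "n dvd (i + e) - (i + d)"
    by (metis mod_eq_dvd_iff_nat assms(1) nat_add_left_cancel_le order_less_imp_le)
  then show False using assms by (auto dest: dvd_imp_le)
qed

lemma nbhd_petersen2: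
  assumes "n \<ge> 1"
  shows "nbhd (petersen n 2) (2 * ((i + 3) mod n)) =
      {2 * ((i + 2) mod n), 2 * ((i + 4) mod n), 2 * ((i + 3) mod n) + 1}"
    and "nbhd (petersen n 2) (2 * ((i + 2) mod n) + 1) =
      {2 * (i mod n) + 1, 2 * ((i + 4) mod n) + 1, 2 * ((i + 2) mod n)}"
  using nbhd_outer [OF assms, of 2 "i + 2"] nbhd_inner [OF assms, of 2 i]
  by (simp_all add: numeral_eq_Suc)

lemma italian_dominating_iff_linked:
  assumes "n \<ge> 5"
  shows "italian_dominating (petersen n 2) f \<longleftrightarrow> linked italian_at (columns n f)"
proof -
  let ?P = "\<lambda>v. f v \<le> 2 \<and> (f v = 0 \<longrightarrow> 2 \<le> (\<Sum>u\<in>nbhd (petersen n 2) v. f u))"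
  have "f v \<in> {0, 1, 2} \<longleftrightarrow> f v \<le> 2" for v by auto
  then have "italian_dominating (petersen n 2) f \<longleftrightarrow> (\<forall>v<2 * n. ?P v)"
    by (auto simp: italian_dominating_def)
  also have "\<dots> \<longleftrightarrow> (\<forall>i. ?P (2 * ((i + 3) mod n)) \<and> ?P (2 * ((i + 2) mod n) + 1))"
    using assms by (intro all_vertices_iff_columns) simp
  also have "\<dots> \<longleftrightarrow> linked italian_at (columns n f)"
  proof -
    have parity: "2 * a \<noteq> 2 * b + 1" "2 * b + 1 \<noteq> 2 * a" for a b :: nat by presburger+
    have n_pos: "n \<ge> 1" using assms by simp
    have "(i + 2) mod n \<noteq> (i + 4) mod n" "i mod n \<noteq> (i + 4) mod n" for i
      using distinct_columns [of 2 4 n i] distinct_columns [of 0 4 n i] assms by simp_all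
    then have "(\<Sum>u\<in>nbhd (petersen n 2) (2 * ((i + 3) mod n)). f u) =
        f (2 * ((i + 2) mod n)) + f (2 * ((i + 4) mod n)) + f (2 * ((i + 3) mod n) + 1)"
      "(\<Sum>u\<in>nbhd (petersen n 2) (2 * ((i + 2) mod n) + 1). f u) =
        f (2 * (i mod n) + 1) + f (2 * ((i + 4) mod n) + 1) + f (2 * ((i + 2) mod n))" for i
      unfolding nbhd_petersen2 [OF n_pos] using parity by (simp_all add: add.assoc)
    then show ?thesis
      by (simp only: linked_def columns_def italian_at_def link.simps)
  qed
  finally show ?thesis .
qed

lemma rainbow2_dominating_iff_linked:
  assumes "n \<ge> 5"
  shows "rainbow2_dominating (petersen n 2) g \<longleftrightarrow> linked rainbow_at (columns n g)"
proof -
  let ?P = "\<lambda>v. g v \<in> {{}, {1}, {2}, {1, 2}} \<and>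
    (g v = {} \<longrightarrow> (\<Union>u\<in>nbhd (petersen n 2) v. g u) = {1, 2})"
  have "rainbow2_dominating (petersen n 2) g \<longleftrightarrow> (\<forall>v<2 * n. ?P v)"
    by (auto simp: rainbow2_dominating_def)
  also have "\<dots> \<longleftrightarrow> (\<forall>i. ?P (2 * ((i + 3) mod n)) \<and> ?P (2 * ((i + 2) mod n) + 1))"
    using assms by (intro all_vertices_iff_columns) simp
  also have "\<dots> \<longleftrightarrow> linked rainbow_at (columns n g)"
    using assms nbhd_petersen2 [of n]
    by (simp add: linked_def columns_def rainbow_at_def Un_assoc)
  finally show ?thesis .
qed

section \<open>The excess of an Italian dominating function\<close>

text \<open>
  The excess \<open>f(N(v)) + 2 f(v) - 2\<close> of a vertex is split into the part \<open>own\<close>, which is known as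
  soon as the column of the vertex is known, and the part \<open>rest\<close>, which depends on its two
  neighbours in other columns (of total value \<open>s\<close>); \<open>u\<close> is the value of the neighbour in the same
  column.
\<close>
definition own :: "nat \<Rightarrow> nat \<Rightarrow> nat" where
  "own v u = (if v = 0 then 0 else 2 * (v - 1) + u)"

definition rest :: "nat \<Rightarrow> nat \<Rightarrow> nat \<Rightarrow> nat" where
  "rest v s u = (if v = 0 then s + u - 2 else s)"

text \<open>
  The toll of a window \<open>p q r s t\<close> of five columns charges \<open>own\<close> for the last column and \<open>rest\<close> for
  the two vertices checked by \<open>link\<close>. Around the cycle the tolls add up
  to the total excess. Charging \<open>own\<close> as early as possible lets the search below stop earlier, and
  this is what keeps the windows that it needs at most as long as the cycle, even for \<open>n = 8\<close>.
\<close>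
fun toll :: "nat \<times> nat \<Rightarrow> nat \<times> nat \<Rightarrow> nat \<times> nat \<Rightarrow> nat \<times> nat \<Rightarrow> nat" where
  "toll (pa, pb) (ra, rb) (sa, sb) (ta, tb) =
     own ta tb + own tb ta + rest sa (ra + ta) sb + rest rb (pb + tb) ra"

lemma sum_shift_periodic:
  fixes h :: "nat \<Rightarrow> nat"
  assumes "\<And>i. h (i + n) = h i"
  shows "(\<Sum>i<n. h (i + k)) = (\<Sum>i<n. h i)"
proof (induction k)
  case (Suc k)
  have "(\<Sum>i<n. h (Suc i + k)) + h k = (\<Sum>i<Suc n. h (i + k))"
    by (subst sum.lessThan_Suc_shift) simp
  also have "\<dots> = (\<Sum>i<n. h (i + k)) + h k"
    using assms [of k] by (simp add: add.commute)
  finally show ?case using Suc by simp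
qed simp

locale italian_cycle =
  fixes n :: nat and c :: "nat \<Rightarrow> nat \<times> nat"
  assumes n_ge_5: "n \<ge> 5"
    and periodic: "c (i + n) = c i"
    and linked: "linked italian_at c"
begin

definition excess_at :: "nat \<Rightarrow> nat" where
  "excess_at i = toll (c i) (c (i + 2)) (c (i + 3)) (c (i + 4))"

definition excess :: nat where
  "excess = (\<Sum>i<n. excess_at i)"

definition weight :: nat where
  "weight = (\<Sum>i<n. fst (c i) + snd (c i))"

lemma link_at: "link italian_at (c i) (c (i + 1)) (c (i + 2)) (c (i + 3)) (c (i + 4))"
  using linked by (auto simp: linked_def)

lemma outer_at:
  "italian_at (fst (c (i + 3))) (fst (c (i + 2))) (fst (c (i + 4))) (snd (c (i + 3)))"
  using link_at [of i] by (metis link.simps prod.collapse)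

lemma inner_at:
  "italian_at (snd (c (i + 2))) (snd (c i)) (snd (c (i + 4))) (fst (c (i + 2)))"
  using link_at [of i] by (metis link.simps prod.collapse)

lemma own_plus_rest:
  assumes "italian_at v x y u"
  shows "own v u + rest v (x + y) u + 2 = x + y + u + 2 * v"
  using assms by (auto simp: italian_at_def own_def rest_def)

text \<open>
  Double counting: every vertex has three neighbours, so the values \<open>f(N(v))\<close> add up to three times
  the weight.
\<close>
lemma excess_eq: "excess + 4 * n = 5 * weight"
proof -
  define a where "a i = fst (c i)" for i
  define b where "b i = snd (c i)" for i
  define ra where "ra i = rest (a (i + 1)) (a i + a (i + 2)) (b (i + 1))" for i
  define rb where "rb i = rest (b (i + 2)) (b i + b (i + 4)) (a (i + 2))" for i
  define w where "w i = own (a i) (b i) + own (b i) (a i)" for i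
  have per: "a (i + n) = a i" "b (i + n) = b i" for i
    by (simp_all add: a_def b_def periodic)
  have per': "ra (i + n) = ra i" "rb (i + n) = rb i" "w (i + n) = w i" for i
    using per [of "i + 1"] per [of "i + 2"] per [of "i + 4"] per [of i]
    by (simp_all add: ra_def rb_def w_def ac_simps)
  have "excess_at i = w (i + 4) + ra (i + 2) + rb i" for i
    unfolding excess_at_def w_def ra_def rb_def a_def b_def
    by (cases "c i"; cases "c (i + 2)"; cases "c (i + 3)"; cases "c (i + 4)")
      (simp add: numeral_eq_Suc)
  then have "excess = (\<Sum>i<n. w (i + 4)) + (\<Sum>i<n. ra (i + 2)) + (\<Sum>i<n. rb i)"
    by (simp add: excess_def sum.distrib)
  also have "\<dots> = (\<Sum>i<n. own (a (i + 3)) (b (i + 3)) + ra (i + 2)) +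
      (\<Sum>i<n. own (b (i + 2)) (a (i + 2)) + rb i)"
    using sum_shift_periodic [of w, OF per'(3)]
      sum_shift_periodic [of "\<lambda>i. own (a i) (b i)" n] sum_shift_periodic [of "\<lambda>i. own (b i) (a i)" n]
    by (simp add: per sum.distrib w_def del: add_2_eq_Suc' add_Suc_right)
  finally have "excess + 4 * n = (\<Sum>i<n. own (a (i + 3)) (b (i + 3)) + ra (i + 2) + 2) +
      (\<Sum>i<n. own (b (i + 2)) (a (i + 2)) + rb i + 2)"
    by (simp only: sum.distrib sum_constant card_lessThan) simp
  also have "\<dots> = (\<Sum>i<n. a (i + 2) + a (i + 4) + b (i + 3) + 2 * a (i + 3)) +
      (\<Sum>i<n. b i + b (i + 4) + a (i + 2) + 2 * b (i + 2))"
  proof -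
    have "own (a (i + 3)) (b (i + 3)) + ra (i + 2) + 2 =
        a (i + 2) + a (i + 4) + b (i + 3) + 2 * a (i + 3)"
      "own (b (i + 2)) (a (i + 2)) + rb i + 2 =
        b i + b (i + 4) + a (i + 2) + 2 * b (i + 2)" for i
      using own_plus_rest [OF outer_at [of i]] own_plus_rest [OF inner_at [of i]]
      by (simp_all add: a_def b_def ra_def rb_def numeral_eq_Suc)
    then show ?thesis by simp
  qed
  also have "\<dots> = 5 * weight"
    using sum_shift_periodic [of a, OF per(1)] sum_shift_periodic [of b, OF per(2)]
    by (simp add: sum.distrib weight_def a_def [symmetric] b_def [symmetric] sum_distrib_left [symmetric]
        del: add_2_eq_Suc' add_Suc_right)
  finally show ?thesis .
qed

lemma excess_at_periodic: "excess_at (i + n) = excess_at i"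
  using periodic [of i] periodic [of "i + 2"] periodic [of "i + 3"] periodic [of "i + 4"]
  by (simp add: excess_at_def ac_simps)

lemma window_excess:
  assumes "k \<le> n"
  shows "(\<Sum>i<k. excess_at (s + i)) \<le> excess"
proof -
  have "(\<Sum>i<k. excess_at (s + i)) \<le> (\<Sum>i<n. excess_at (s + i))"
    using assms by (intro sum_mono2) auto
  also have "\<dots> = excess"
    using sum_shift_periodic [of excess_at, OF excess_at_periodic]
    by (simp add: excess_def add.commute [of s])
  finally show ?thesis .
qed

text \<open>
  If no two consecutive tolls vanished, then the sums of two consecutive tolls, each at least 1, would
  add up to at least \<open>n\<close>, but every toll occurs in two of them. A quiet pair drastically reduces the
  number of possible beginnings of a search.
\<close>
lemma quiet_pair:
  assumes "2 * excess < n"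
  obtains j where "excess_at j = 0" "excess_at (j + 1) = 0"
proof -
  have "\<exists>j. excess_at j + excess_at (j + 1) = 0"
  proof (rule ccontr)
    assume "\<not> ?thesis"
    then have pos: "1 \<le> excess_at i + excess_at (i + 1)" for i
      by (metis One_nat_def Suc_leI neq0_conv)
    have "n = (\<Sum>i<n. 1)" by simp
    also have "\<dots> \<le> (\<Sum>i<n. excess_at i + excess_at (i + 1))"
      by (intro sum_mono pos)
    also have "\<dots> = 2 * excess"
      using sum_shift_periodic [of excess_at, OF excess_at_periodic]
      by (simp only: sum.distrib excess_def)
    finally show False using assms by simp
  qed
  then show ?thesis using that by auto
qed

end

section \<open>Low excess forces the columns\<close>

definition letters :: "(nat \<times> nat) list" where
  "letters = List.product [0, 1, 2] [0, 1, 2]"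

text \<open>
  Exhaustive search over the prolongations by at most \<open>k\<close> columns of a window \<open>w\<close>, which is stored in
  reverse so that the newest column is its head. A branch is abandoned when the local conditions
  fail or the tolls exceed the budget \<open>e\<close>; the result is true if every other branch meets the goal
  \<open>Q\<close>. The conditionals are nested for the evaluation by rewriting: their branches are not rewritten
  before the condition is decided.
\<close>
primrec search :: "((nat \<times> nat) list \<Rightarrow> bool) \<Rightarrow> nat \<Rightarrow> nat \<Rightarrow> (nat \<times> nat) list \<Rightarrow> bool" where
  "search Q 0 e w = Q w"
| "search Q (Suc k) e w =
     (if Q w then True
      else list_all (\<lambda>t.
        case w of
          s # r # q # p # _ \<Rightarrow>
            (if link italian_at p q r s t then
               (if toll p r s t \<le> e then search Q k (e - toll p r s t) (t # w) else True)
             else True)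
        | _ \<Rightarrow> True) letters)"

text \<open>
  A palindrome, hence insensitive to the reversed storage of windows.
\<close>
definition block :: "(nat \<times> nat) list" where
  "block = [(1, 0), (0, 1), (0, 1), (1, 0)]"

text \<open>
  Consequences of two consecutive vanishing tolls for the last four of the six columns involved. The
  values of the first two columns only enter through the last two equations, which are weakened by
  replacing these values by 0.
\<close>
definition quiet :: "nat \<times> nat \<Rightarrow> nat \<times> nat \<Rightarrow> nat \<times> nat \<Rightarrow> nat \<times> nat \<Rightarrow> bool" where
  "quiet r s t u \<longleftrightarrow>
     italian_at (fst s) (fst r) (fst t) (snd s) \<and> rest (fst s) (fst r + fst t) (snd s) = 0 \<and>
     italian_at (fst t) (fst s) (fst u) (snd t) \<and> rest (fst t) (fst s + fst u) (snd t) = 0 \<and>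
     rest (snd r) (snd t) (fst r) = 0 \<and> rest (snd s) (snd u) (fst s) = 0"

definition all_quiet :: "((nat \<times> nat) list \<Rightarrow> bool) \<Rightarrow> bool" where
  "all_quiet P \<longleftrightarrow>
     (let Z = filter (\<lambda>t. own (fst t) (snd t) + own (snd t) (fst t) = 0) letters
      in list_all (\<lambda>r. list_all (\<lambda>s. list_all (\<lambda>t. list_all (\<lambda>u.
           if quiet r s t u then P [u, t, s, r] else True) Z) Z) letters) letters)"

lemma search_quiet_2: "all_quiet (search (\<lambda>w. take 4 w = block) 5 2)"
  unfolding eval_nat_numeral BitM.simps by code_simp

lemma search_quiet_3: "all_quiet (search (\<lambda>w. take 4 w = block) 8 3)"
  unfolding eval_nat_numeral BitM.simps by code_simp

lemma search_block_2: "search (\<lambda>w. w = block @ (0, 0) # block) 5 2 block"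
  unfolding eval_nat_numeral BitM.simps by code_simp

lemma search_block_3:
  "search (\<lambda>w. w = block @ (0, 0) # block \<or> w = block @ tl block) 9 3 block"
  unfolding eval_nat_numeral BitM.simps by code_simp

text \<open>
  For \<open>n = 8\<close> a window may have only eight tolls. Then one branch survives that meets neither kind
  of next block, but it cannot close up: its ninth column would have to be the first one again.
\<close>
lemma search_block_closed_3:
  "search (\<lambda>w. w = block @ (0, 0) # block \<or> w = block @ tl block \<or>
     length w = 9 \<and> hd w \<noteq> (1, 0)) 8 3 block"
  unfolding eval_nat_numeral BitM.simps by code_simp

lemma all_quietD:
  assumes "all_quiet P" "quiet r s t u"
    and "r \<in> set letters" "s \<in> set letters" "t \<in> set letters" "u \<in> set letters"
    and "own (fst t) (snd t) + own (snd t) (fst t) = 0"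
    and "own (fst u) (snd u) + own (snd u) (fst u) = 0"
  shows "P [u, t, s, r]"
proof -
  have "if quiet r s t u then P [u, t, s, r] else True"
    using assms(1,3-8) unfolding all_quiet_def Let_def list_all_iff set_filter by blast
  then show ?thesis using assms(2) by simp
qed

context italian_cycle
begin

lemma column_in_letters: "c i \<in> set letters"
proof -
  have i: "i + n = (i + (n - 3)) + 3" "i + n = (i + (n - 2)) + 2" using n_ge_5 by simp_all
  have "fst (c (i + n)) \<le> 2" "snd (c (i + n)) \<le> 2"
    using outer_at [of "i + (n - 3)"] inner_at [of "i + (n - 2)"]
    unfolding i [symmetric] italian_at_def by blast+
  then have "fst (c i) \<in> {0, 1, 2}" "snd (c i) \<in> {0, 1, 2}"
    unfolding periodic by auto
  then show ?thesis
    by (cases "c i") (auto simp: letters_def)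
qed

lemma search_sound:
  assumes "search Q k e (rev (map c [j..<m + 4]))" "j \<le> m"
    and "(\<Sum>i<k. excess_at (m + i)) \<le> e"
  shows "\<exists>i\<le>k. Q (rev (map c [j..<m + i + 4]))"
  using assms
proof (induction k arbitrary: e m)
  case (Suc k)
  let ?w = "rev (map c [j..<m + 4])"
  have w: "?w = c (m + 3) # c (m + 2) # c (m + 1) # c m # rev (map c [j..<m])"
    using \<open>j \<le> m\<close> by (simp add: numeral_eq_Suc)
  have w': "c (m + 4) # ?w = rev (map c [j..<Suc m + 4])"
    using \<open>j \<le> m\<close> upt_Suc_append [of j "m + 4"] by simp
  have sum: "(\<Sum>i<Suc k. excess_at (m + i)) = excess_at m + (\<Sum>i<k. excess_at (Suc m + i))"
    by (subst sum.lessThan_Suc_shift) simp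
  show ?case
  proof (cases "Q ?w")
    case True
    then show ?thesis by (intro exI [of _ 0]) simp
  next
    case False
    have all: "\<forall>t\<in>set letters.
        if link italian_at (c m) (c (m + 1)) (c (m + 2)) (c (m + 3)) t then
          (if toll (c m) (c (m + 2)) (c (m + 3)) t \<le> e
           then search Q k (e - toll (c m) (c (m + 2)) (c (m + 3)) t) (t # ?w) else True)
        else True"
      using Suc.prems(1) False unfolding w by (simp add: list_all_iff)
    have "excess_at m \<le> e"
      using Suc.prems(3) unfolding sum by (rule add_leD1)
    then have "search Q k (e - excess_at m) (c (m + 4) # ?w)"
      using bspec [OF all column_in_letters [of "m + 4"]] link_at [of m]
      unfolding excess_at_def by (simp only: if_True)
    then have "\<exists>i\<le>k. Q (rev (map c [j..<Suc m + i + 4]))"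
      unfolding w' using Suc.prems(2,3) sum by (intro Suc.IH [of "e - excess_at m"]) simp_all
    then show ?thesis by (metis Suc_le_mono add_Suc add_Suc_right)
  qed
qed auto

definition block_at :: "nat \<Rightarrow> bool" where
  "block_at s \<longleftrightarrow> c s = (1, 0) \<and> c (s + 1) = (0, 1) \<and> c (s + 2) = (0, 1) \<and> c (s + 3) = (1, 0)"

lemma rev_window: "rev (map c [s..<s + 4]) = block \<longleftrightarrow> block_at s"
  by (auto simp: block_def block_at_def numeral_eq_Suc)

lemma take_rev_window:
  "j \<le> m \<Longrightarrow> take 4 (rev (map c [j..<m + 4])) = rev (map c [m..<m + 4])"
  by (simp add: numeral_eq_Suc)

text \<open>
  Start the search right after a quiet pair. The bound \<open>n \<ge> 8\<close> is the number of tolls that the search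
  with budget 3 needs; a window of at most \<open>n\<close> tolls costs at most the total excess.
\<close>
lemma block_exists:
  assumes "2 * excess < n" "excess \<le> 2 \<or> excess \<le> 3 \<and> n \<ge> 8"
  shows "\<exists>s. block_at s"
proof -
  obtain j where j: "excess_at j = 0" "excess_at (j + 1) = 0"
    using quiet_pair assms by blast
  let ?m = "j + 2"
  let ?r = "c (j + 2)" and ?s = "c (j + 3)" and ?t = "c (j + 4)" and ?u = "c (j + 5)"
  let ?own = "\<lambda>t. own (fst t) (snd t) + own (snd t) (fst t)"
  have toll: "toll p r s t = ?own t + rest (fst s) (fst r + fst t) (snd s) +
      rest (snd r) (snd p + snd t) (fst r)" for p r s t
    by (metis prod.collapse toll.simps)
  have own: "?own ?t = 0" "?own ?u = 0"
    and rest: "rest (fst ?s) (fst ?r + fst ?t) (snd ?s) = 0" "rest (fst ?t) (fst ?s + fst ?u) (snd ?t) = 0"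
      "rest (snd ?r) (snd (c j) + snd ?t) (fst ?r) = 0"
      "rest (snd ?s) (snd (c (j + 1)) + snd ?u) (fst ?s) = 0"
    using j unfolding excess_at_def toll by (simp_all add: numeral_eq_Suc)
  have mono: "rest v (x + y) z = 0 \<Longrightarrow> rest v y z = 0" for v x y z
    by (simp add: rest_def split: if_splits)
  have "quiet ?r ?s ?t ?u"
    unfolding quiet_def using outer_at [of j] outer_at [of "j + 1"] rest
    by (auto dest: mono simp: numeral_eq_Suc)
  moreover have "rev (map c [?m..<?m + 4]) = [?u, ?t, ?s, ?r]"
    by (simp add: numeral_eq_Suc)
  ultimately have sound: "P (rev (map c [?m..<?m + 4]))" if "all_quiet P" for P
    using all_quietD [OF that _ _ _ _ _ own] column_in_letters by simp
  have "\<exists>k. \<exists>i\<le>k. take 4 (rev (map c [?m..<?m + i + 4])) = block"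
  proof (cases "excess \<le> 2")
    case True
    then have "(\<Sum>i<5. excess_at (?m + i)) \<le> 2"
      using window_excess [of 5 ?m] n_ge_5 by linarith
    then show ?thesis
      using search_sound [OF sound [OF search_quiet_2] le_refl] by blast
  next
    case False
    then have "(\<Sum>i<8. excess_at (?m + i)) \<le> 3"
      using window_excess [of 8 ?m] assms(2) by linarith
    then show ?thesis
      using search_sound [OF sound [OF search_quiet_3] le_refl] by blast
  qed
  then obtain i where "take 4 (rev (map c [?m..<?m + i + 4])) = block" by blast
  then have "block_at (?m + i)"
    by (simp only: take_rev_window le_add1 rev_window)
  then show ?thesis by blast
qed

lemma long_block:
  assumes "rev (map c [s..<s + i + 4]) = block @ (0, 0) # block"
  shows "c (s + 4) = (0, 0) \<and> block_at (s + 5)"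
proof -
  have "i = 5" using arg_cong [OF assms, of length] by (simp add: block_def)
  with assms show ?thesis
    by (simp add: block_def block_at_def upt_rec numeral_eq_Suc)
qed

lemma short_block:
  assumes "rev (map c [s..<s + i + 4]) = block @ tl block"
  shows "block_at (s + 3)"
proof -
  have "i = 3" using arg_cong [OF assms, of length] by (simp add: block_def)
  with assms show ?thesis
    by (simp add: block_def block_at_def upt_rec numeral_eq_Suc)
qed

lemma next_block_low:
  assumes "excess \<le> 2" "block_at s"
  shows "c (s + 4) = (0, 0) \<and> block_at (s + 5)"
proof -
  have "search (\<lambda>w. w = block @ (0, 0) # block) 5 2 (rev (map c [s..<s + 4]))"
    unfolding rev_window [THEN iffD2, OF assms(2)] by (rule search_block_2)
  moreover have "(\<Sum>i<5. excess_at (s + i)) \<le> 2"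
    using window_excess [of 5 s] n_ge_5 assms(1) by simp
  ultimately obtain i where "rev (map c [s..<s + i + 4]) = block @ (0, 0) # block"
    using search_sound by blast
  then show ?thesis by (rule long_block)
qed

lemma next_block:
  assumes "excess \<le> 3" "n \<ge> 8" "block_at s"
  shows "c (s + 4) = (0, 0) \<and> block_at (s + 5) \<or> block_at (s + 3)"
proof (cases "n = 8")
  case False
  have "search (\<lambda>w. w = block @ (0, 0) # block \<or> w = block @ tl block) 9 3 (rev (map c [s..<s + 4]))"
    unfolding rev_window [THEN iffD2, OF assms(3)] by (rule search_block_3)
  moreover have "(\<Sum>i<9. excess_at (s + i)) \<le> 3"
    using window_excess [of 9 s] False assms by simp
  ultimately obtain i where "rev (map c [s..<s + i + 4]) = block @ (0, 0) # block \<or>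
      rev (map c [s..<s + i + 4]) = block @ tl block"
    using search_sound by blast
  then show ?thesis using long_block short_block by blast
next
  case True
  let ?Q = "\<lambda>w. w = block @ (0, 0) # block \<or> w = block @ tl block \<or> length w = 9 \<and> hd w \<noteq> (1, 0)"
  have "search ?Q 8 3 (rev (map c [s..<s + 4]))"
    unfolding rev_window [THEN iffD2, OF assms(3)] by (rule search_block_closed_3)
  moreover have "(\<Sum>i<8. excess_at (s + i)) \<le> 3"
    using window_excess [of 8 s] True assms by simp
  ultimately obtain i where i: "?Q (rev (map c [s..<s + i + 4]))"
    using search_sound by blast
  have "c (s + 8) = (1, 0)"
    using periodic [of s] assms(3) True by (simp add: block_at_def)
  moreover have "hd (rev (map c [s..<s + i + 4])) = c (s + i + 3)"
    using upt_Suc_append [of s "s + i + 3"] by (simp add: numeral_eq_Suc)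
  ultimately have "\<not> (length (rev (map c [s..<s + i + 4])) = 9 \<and> hd (rev (map c [s..<s + i + 4])) \<noteq> (1, 0))"
    by (auto simp: eval_nat_numeral)
  then show ?thesis using i long_block short_block by blast
qed

lemma short_block_excess:
  assumes "block_at s" "block_at (s + 3)"
  shows "(\<Sum>i<3. excess_at (s + i)) = 3"
  using assms
  by (simp add: block_at_def excess_at_def own_def rest_def numeral_eq_Suc)

text \<open>
  Two disjoint overlaps of blocks would cost excess 6.
\<close>
lemma short_block_unique:
  assumes "excess \<le> 3" "block_at s" "block_at (s + 3)" "s + 3 \<le> t" "t + 3 \<le> s + n"
    and "block_at t" "block_at (t + 3)"
  shows False
proof -
  have "3 + 3 = (\<Sum>i\<in>{s..<s + 3}. excess_at i) + (\<Sum>i\<in>{t..<t + 3}. excess_at i)"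
    using short_block_excess [of s] short_block_excess [of t] assms
    by (simp add: sum.atLeastLessThan_shift_0 [of _ s] sum.atLeastLessThan_shift_0 [of _ t] atLeast0LessThan)
  also have "\<dots> = (\<Sum>i\<in>{s..<s + 3} \<union> {t..<t + 3}. excess_at i)"
    using assms by (subst sum.union_disjoint) auto
  also have "\<dots> \<le> (\<Sum>i\<in>{s..<s + n}. excess_at i)"
    using assms by (intro sum_mono2) auto
  also have "\<dots> \<le> excess"
    using window_excess [of n s] by (simp add: sum.atLeastLessThan_shift_0 [of _ s] atLeast0LessThan)
  finally show False using assms(1) by simp
qed

text \<open>
  No block starts in one of the columns 1 to 4 after the start of a block that is followed by
  \<open>00\<close>, so the steps of length 5 cannot jump over the block at \<open>s + d\<close>.
\<close>
lemma chain_of_long_blocks: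
  assumes "block_at s" "block_at (s + d)"
    and "\<And>t. s \<le> t \<Longrightarrow> t < s + d \<Longrightarrow> block_at t \<Longrightarrow> c (t + 4) = (0, 0) \<and> block_at (t + 5)"
  shows "\<exists>p. d = 5 * p \<and> (\<forall>j\<le>p. block_at (s + 5 * j)) \<and> (\<forall>j<p. c (s + 5 * j + 4) = (0, 0))"
  using assms
proof (induction d arbitrary: s rule: less_induct)
  case (less d)
  show ?case
  proof (cases "d = 0")
    case True
    then show ?thesis using less.prems by auto
  next
    case False
    have next_block: "c (s + 4) = (0, 0)" "block_at (s + 5)"
      using less.prems(3) [of s] less.prems(1) False by auto
    have "d \<noteq> 1" "d \<noteq> 2" "d \<noteq> 3" "d \<noteq> 4"
      using less.prems(1,2) next_block(1) by (auto simp: block_at_def numeral_eq_Suc)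
    then have "d \<ge> 5" using False by linarith
    then have "\<exists>p. d - 5 = 5 * p \<and> (\<forall>j\<le>p. block_at (s + 5 + 5 * j)) \<and>
        (\<forall>j<p. c (s + 5 + 5 * j + 4) = (0, 0))"
      using less.prems next_block(2) by (intro less.IH) auto
    then obtain p where p: "d - 5 = 5 * p" "\<forall>j\<le>p. block_at (s + 5 + 5 * j)"
      "\<forall>j<p. c (s + 5 + 5 * j + 4) = (0, 0)" by blast
    show ?thesis
    proof (intro exI conjI allI impI)
      show "d = 5 * Suc p" using p(1) \<open>d \<ge> 5\<close> by simp
      show "block_at (s + 5 * j)" if "j \<le> Suc p" for j
        using that p(2) less.prems(1) by (cases j) (auto simp: add.assoc)
      show "c (s + 5 * j + 4) = (0, 0)" if "j < Suc p" for j
        using that p(3) next_block(1) by (cases j) (auto simp: add.assoc)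
    qed
  qed
qed

lemma block_at_periodic: "block_at (s + n) = block_at s"
  using periodic [of s] periodic [of "s + 1"] periodic [of "s + 2"] periodic [of "s + 3"]
  by (simp add: block_at_def ac_simps)

text \<open>
  A step of length 3 is not affordable, so \<open>n\<close> is a multiple of 5, and so is
  \<open>excess = 5 * weight - 4 * n\<close>.
\<close>
lemma excess_not_1_2:
  "excess \<noteq> 1" "excess \<noteq> 2"
proof -
  have "5 dvd excess" if low: "excess \<le> 2"
  proof -
    have "2 * excess < n" using low n_ge_5 by linarith
    then obtain s where s: "block_at s"
      using block_exists low by blast
    then have "block_at (s + n)" by (simp add: block_at_periodic)
    then obtain p where "n = 5 * p"
      using chain_of_long_blocks [OF s] next_block_low [OF low] by blast
    then show ?thesis using excess_eq by presburger
  qed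
  then show "excess \<noteq> 1" "excess \<noteq> 2" by auto
qed

end

section \<open>Colouring the blocks\<close>

lemma rainbow_at_card:
  assumes "rainbow_at v x y z"
  shows "italian_at (card v) (card x) (card y) (card z)"
proof -
  have "2 \<le> card x + card y + card z" if "v = {}"
  proof -
    have "card (x \<union> y \<union> z) = 2" using assms that by (simp add: rainbow_at_def)
    then show ?thesis
      using card_Un_le [of "x \<union> y" z] card_Un_le [of x y] by linarith
  qed
  then show ?thesis
    using assms by (auto simp: rainbow_at_def italian_at_def)
qed

lemma rainbow_at_permute:
  "rainbow_at v x y z \<Longrightarrow> rainbow_at v y z x" "rainbow_at v x y z \<Longrightarrow> rainbow_at v x z y"
  by (auto simp: rainbow_at_def)

text \<open>
  The source of all information on hues: if one neighbour of an empty vertex is empty as well and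
  another carries a single hue, then the remaining one must contribute the other hue.
\<close>
lemma rainbow_at_differ:
  assumes "rainbow_at v x y z" "card v = 0" "card x = 1" "card z = 0" "finite z"
  shows "x \<noteq> y"
  using assms by (auto simp: rainbow_at_def)

locale rainbow_cycle =
  fixes n :: nat and d :: "nat \<Rightarrow> nat set \<times> nat set"
  assumes n_ge_5: "n \<ge> 5"
    and d_periodic: "d (i + n) = d i"
    and d_linked: "linked rainbow_at d"

sublocale rainbow_cycle \<subseteq> italian_cycle n "\<lambda>i. map_prod card card (d i)"
proof
  have "link italian_at (map_prod card card p) (map_prod card card q) (map_prod card card r)
      (map_prod card card s) (map_prod card card t)" if "link rainbow_at p q r s t" for p q r s t
    using that by (cases p; cases q; cases r; cases s; cases t) (simp add: rainbow_at_card)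
  then show "linked italian_at (\<lambda>i. map_prod card card (d i))"
    using d_linked by (simp add: linked_def)
qed (simp_all add: n_ge_5 d_periodic)

context rainbow_cycle
begin

lemma rainbow_outer:
  "rainbow_at (fst (d (i + 1))) (fst (d i)) (fst (d (i + 2))) (snd (d (i + 1)))"
proof -
  define j where "j = i + (n - 2)"
  have "link rainbow_at (d j) (d (j + 1)) (d (j + 2)) (d (j + 3)) (d (j + 4))"
    using d_linked by (simp add: linked_def)
  then have "rainbow_at (fst (d (j + 3))) (fst (d (j + 2))) (fst (d (j + 4))) (snd (d (j + 3)))"
    by (metis link.simps prod.collapse)
  moreover have "j + 3 = (i + 1) + n" "j + 2 = i + n" "j + 4 = (i + 2) + n"
    using n_ge_5 by (simp_all add: j_def)
  ultimately show ?thesis by (simp only: d_periodic)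
qed

lemma rainbow_inner:
  "rainbow_at (snd (d (i + 2))) (snd (d i)) (snd (d (i + 4))) (fst (d (i + 2)))"
proof -
  have "link rainbow_at (d i) (d (i + 1)) (d (i + 2)) (d (i + 3)) (d (i + 4))"
    using d_linked by (simp add: linked_def)
  then show ?thesis by (metis link.simps prod.collapse)
qed

lemma hues:
  "fst (d i) \<in> {{}, {1}, {2}, {1, 2}}" "snd (d i) \<in> {{}, {1}, {2}, {1, 2}}"
proof -
  have "fst (d (i + 1 + (n - 1))) \<in> {{}, {1}, {2}, {1, 2}}"
    using rainbow_outer [of "i + (n - 1)"] by (simp add: rainbow_at_def)
  moreover have "i + 1 + (n - 1) = i + n" using n_ge_5 by simp
  ultimately show "fst (d i) \<in> {{}, {1}, {2}, {1, 2}}" by (simp only: d_periodic)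
  have "snd (d (i + (n - 2) + 2)) \<in> {{}, {1}, {2}, {1, 2}}"
    using rainbow_inner [of "i + (n - 2)"] by (simp add: rainbow_at_def)
  moreover have "i + (n - 2) + 2 = i + n" using n_ge_5 by simp
  ultimately show "snd (d i) \<in> {{}, {1}, {2}, {1, 2}}" by (simp only: d_periodic)
qed

lemma finite_hues [simp]: "finite (fst (d i))" "finite (snd (d i))"
proof -
  have "finite x" if "x \<in> {{}, {1}, {2}, {1, 2}}" for x :: "nat set"
    using that by auto
  then show "finite (fst (d i))" "finite (snd (d i))"
    using hues [of i] by blast+
qed

lemma block_cards:
  assumes "block_at s"
  shows "card (fst (d s)) = 1" "card (snd (d s)) = 0"
    "card (fst (d (s + 1))) = 0" "card (snd (d (s + 1))) = 1"
    "card (fst (d (s + 2))) = 0" "card (snd (d (s + 2))) = 1"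
    "card (fst (d (s + 3))) = 1" "card (snd (d (s + 3))) = 0"
proof -
  have "map_prod card card x = (i, j) \<longleftrightarrow> card (fst x) = i \<and> card (snd x) = j"
    for x :: "nat set \<times> nat set" and i j
    by (cases x) simp
  then show "card (fst (d s)) = 1" "card (snd (d s)) = 0"
    "card (fst (d (s + 1))) = 0" "card (snd (d (s + 1))) = 1"
    "card (fst (d (s + 2))) = 0" "card (snd (d (s + 2))) = 1"
    "card (fst (d (s + 3))) = 1" "card (snd (d (s + 3))) = 0"
    using assms unfolding block_at_def by blast+
qed

lemma two_hues:
  assumes "card x = 1" "card y = 1" "card z = 1" "x \<noteq> y" "y \<noteq> z"
    and "x \<in> {{}, {1}, {2}, {1, 2}}" "y \<in> {{}, {1}, {2}, {1, 2}}" "z \<in> {{}, {1}, {2}, {1, 2 :: nat}}"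
  shows "x = z"
  using assms by auto

text \<open>
  In the block starting at \<open>s\<close>, the outer vertex \<open>s + 1\<close> and the inner vertex \<open>s + 3\<close> make the inner
  vertex \<open>s + 1\<close> differ from both outer ends of the block, so these have equal hues. The outer vertex of
  the separating column \<open>s + 4\<close> then exchanges the hue.
\<close>
lemma long_block_swaps:
  assumes "block_at s" "map_prod card card (d (s + 4)) = (0, 0)" "block_at (s + 5)"
  shows "fst (d (s + 5)) \<noteq> fst (d s)"
proof -
  note cards = block_cards [OF assms(1)] block_cards [OF assms(3)]
  have zero: "card (fst (d (s + 4))) = 0" "card (snd (d (s + 4))) = 0"
    using assms(2) by (cases "d (s + 4)"; simp)+
  have "fst (d s) \<noteq> snd (d (s + 1))"
    using rainbow_at_differ [OF rainbow_at_permute(2) [OF rainbow_outer [of s]]] cards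
    by (simp add: numeral_eq_Suc)
  moreover have "snd (d (s + 1)) \<noteq> fst (d (s + 3))"
    using rainbow_at_differ [OF rainbow_at_permute(2) [OF rainbow_inner [of "s + 1"]]] cards
    by (simp add: numeral_eq_Suc)
  ultimately have "fst (d s) = fst (d (s + 3))"
    using two_hues [OF _ _ _ _ _ hues(1) hues(2) hues(1)] cards by blast
  moreover have "fst (d (s + 3)) \<noteq> fst (d (s + 5))"
    using rainbow_at_differ [OF rainbow_outer [of "s + 3"]] zero cards
    by (simp add: numeral_eq_Suc)
  ultimately show ?thesis by simp
qed

text \<open>
  The inner vertex \<open>u + 4\<close> differs from both outer ends of the block starting at \<open>u + 2\<close>. At the first
  end this relies on the inner vertex \<open>u\<close> being empty, which holds when the preceding step has
  length 5.
\<close>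
lemma short_block_keeps:
  assumes "card (snd (d u)) = 0" "block_at (u + 2)" "block_at (u + 5)"
  shows "fst (d (u + 5)) = fst (d (u + 2))"
proof -
  note cards = block_cards [OF assms(2)] block_cards [OF assms(3)]
  have "snd (d (u + 4)) \<noteq> fst (d (u + 2))"
    using rainbow_at_differ [OF rainbow_at_permute(1) [OF rainbow_inner [of u]]] assms(1) cards
    by (simp add: numeral_eq_Suc)
  moreover have "fst (d (u + 5)) \<noteq> snd (d (u + 4))"
    using rainbow_at_differ [OF rainbow_at_permute(1) [OF rainbow_outer [of "u + 3"]]] cards
    by (simp add: numeral_eq_Suc)
  ultimately show ?thesis
    using two_hues [OF _ _ _ _ _ hues(1) hues(2) hues(1), of "u + 5" "u + 4" "u + 2"] cards
    by (simp add: numeral_eq_Suc)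
qed

lemma chain_parity:
  assumes "\<forall>j\<le>p. block_at (s + 5 * j)"
    and "\<forall>j<p. map_prod card card (d (s + 5 * j + 4)) = (0, 0)"
  shows "fst (d (s + 5 * p)) = fst (d s) \<longleftrightarrow> even p"
  using assms
proof (induction p)
  case (Suc p)
  have IH: "fst (d (s + 5 * p)) = fst (d s) \<longleftrightarrow> even p"
    using Suc.prems by (intro Suc.IH) auto
  have next_index: "s + 5 * Suc p = s + 5 * p + 5" by simp
  have blocks: "block_at s" "block_at (s + 5 * p)" "block_at (s + 5 * p + 5)"
    using Suc.prems(1) [rule_format, of 0] Suc.prems(1) [rule_format, of p]
      Suc.prems(1) [rule_format, of "Suc p"] by (simp_all only: next_index, simp_all)
  then have "fst (d (s + 5 * p + 5)) \<noteq> fst (d (s + 5 * p))"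
    using Suc.prems(2) by (intro long_block_swaps) auto
  then have "fst (d (s + 5 * p + 5)) = fst (d s) \<longleftrightarrow> fst (d (s + 5 * p)) \<noteq> fst (d s)"
    using two_hues [OF _ _ _ _ _ hues(1) hues(1) hues(1), of "s + 5 * p + 5" "s + 5 * p" s]
      blocks [THEN block_cards(1)] by metis
  then show ?case using IH unfolding next_index by simp
qed simp

lemma excess_not_0:
  assumes "n mod 10 = 5"
  shows "excess \<noteq> 0"
proof
  assume 0: "excess = 0"
  then have low: "excess \<le> 2" and "2 * excess < n" using n_ge_5 by simp_all
  then obtain s where s: "block_at s" using block_exists by blast
  have "block_at (s + n)" using s by (simp add: block_at_periodic)
  then obtain p where p: "n = 5 * p" "\<forall>j\<le>p. block_at (s + 5 * j)"
      "\<forall>j<p. map_prod card card (d (s + 5 * j + 4)) = (0, 0)"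
    using chain_of_long_blocks [OF s] next_block_low [OF low] by blast
  \<comment> \<open>the block at \<open>s + n\<close> is the block at \<open>s\<close> again\<close>
  then have "even p"
    using chain_parity [OF p(2,3)] d_periodic [of s] unfolding p(1) [symmetric] by metis
  then show False using p(1) assms by presburger
qed

text \<open>
  Modulo 5 a step of length 3 must occur, and by its cost it occurs once. Cutting the cycle right after
  it leaves a chain of \<open>(n - 3) / 5\<close> steps of length 5, an odd number.
\<close>
lemma excess_not_3:
  assumes "n mod 10 = 8"
  shows "excess \<noteq> 3"
proof
  assume 3: "excess = 3"
  have "n \<ge> 8" using assms by presburger
  note step = next_block [OF eq_refl [OF 3] this]
  show False
  proof (cases "\<exists>s. block_at s \<and> block_at (s + 3)")
    case False
    have "2 * excess < n" "excess \<le> 3" using 3 \<open>n \<ge> 8\<close> by simp_all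
    then obtain s where s: "block_at s" using block_exists \<open>n \<ge> 8\<close> by blast
    then have "block_at (s + n)" by (simp add: block_at_periodic)
    then obtain p where "n = 5 * p"
      using chain_of_long_blocks [OF s] step False by blast
    then show False using assms by presburger
  next
    case True
    then obtain s where s: "block_at s" "block_at (s + 3)" by blast
    have sn: "block_at (s + n)" "block_at (s + n + 3)"
      using s block_at_periodic [of s] block_at_periodic [of "s + 3"] by (simp_all add: ac_simps)
    have long: "map_prod card card (d (t + 4)) = (0, 0) \<and> block_at (t + 5)"
      if "s + 3 \<le> t" "t < s + n" "block_at t" for t
    proof -
      have "\<not> block_at (t + 3)"
      proof
        assume t3: "block_at (t + 3)"
        have "s + n \<noteq> t + 1" "s + n \<noteq> t + 2"
          using sn(1) that(3) by (auto simp: block_at_def)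
        then have "t + 3 \<le> s + n" using that(2) by linarith
        then show False using short_block_unique [of s t] 3 s that t3 by simp
      qed
      then show ?thesis using step [OF that(3)] by blast
    qed
    have "s + 3 + (n - 3) = s + n" using \<open>n \<ge> 8\<close> by simp
    then obtain p where p: "n - 3 = 5 * p" "\<forall>j\<le>p. block_at (s + 3 + 5 * j)"
        "\<forall>j<p. map_prod card card (d (s + 3 + 5 * j + 4)) = (0, 0)"
      using chain_of_long_blocks [OF s(2), of "n - 3"] sn(1) long by metis
    have "odd p" using p(1) assms \<open>n \<ge> 8\<close> by presburger
    have n: "s + 3 + 5 * p = s + n" using p(1) \<open>n \<ge> 8\<close> by simp
    have "fst (d (s + n)) \<noteq> fst (d (s + 3))"
      using chain_parity [OF p(2,3)] \<open>odd p\<close> unfolding n by blast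
    \<comment> \<open>the last step of length 5 ends the chain, so the column \<open>s + n - 2\<close> is \<open>10\<close>\<close>
    have u: "s + n - 2 + 2 = s + n" "s + n - 2 + 5 = s + n + 3"
      using \<open>n \<ge> 8\<close> by simp_all
    have "block_at (s + 3 + 5 * (p - 1))" using p(2) by simp
    moreover have "s + 3 + 5 * (p - 1) + 3 = s + n - 2"
      using n \<open>odd p\<close> by (cases p) auto
    ultimately have "card (snd (d (s + n - 2))) = 0"
      using block_cards(8) by metis
    then have "fst (d (s + n + 3)) = fst (d (s + n))"
      using short_block_keeps [of "s + n - 2"] sn unfolding u by blast
    moreover have "d (s + n + 3) = d (s + 3)"
      using d_periodic [of "s + 3"] by (simp add: ac_simps)
    ultimately show False
      using \<open>fst (d (s + n)) \<noteq> fst (d (s + 3))\<close> by simp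
  qed
qed

end

section \<open>Dominating functions from words\<close>

definition walk :: "('v \<Rightarrow> 'v \<Rightarrow> 'v \<Rightarrow> 'v \<Rightarrow> bool) \<Rightarrow> ('v \<times> 'v) list \<Rightarrow> bool" where
  "walk D w \<longleftrightarrow>
     (\<forall>i. i + 4 < length w \<longrightarrow> link D (w ! i) (w ! (i + 1)) (w ! (i + 2)) (w ! (i + 3)) (w ! (i + 4)))"

lemma walk_short: "length w \<le> 4 \<Longrightarrow> walk D w"
  by (simp add: walk_def)

lemma walk_Cons:
  "walk D (p # q # r # s # t # w) \<longleftrightarrow> link D p q r s t \<and> walk D (q # r # s # t # w)"
  (is "walk D (p # ?w) \<longleftrightarrow> _")
proof
  assume walk: "walk D (p # ?w)"
  have "link D (?w ! i) (?w ! (i + 1)) (?w ! (i + 2)) (?w ! (i + 3)) (?w ! (i + 4))"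
    if "i + 4 < length ?w" for i
    using walk [unfolded walk_def, rule_format, of "Suc i"] that by simp
  then show "link D p q r s t \<and> walk D ?w"
    using walk [unfolded walk_def, rule_format, of 0] by (simp add: walk_def)
next
  assume "link D p q r s t \<and> walk D ?w"
  then show "walk D (p # ?w)"
    unfolding walk_def
  proof (intro allI impI, goal_cases)
    case (1 i)
    then show ?case by (cases i) auto
  qed
qed

text \<open>
  A word \<open>w\<close> starting like \<open>h\<close> that satisfies all local conditions when \<open>h\<close> follows it. As five
  columns form a window, the four columns of \<open>h\<close> are all that a word has to know about its
  successor. Hence loops at the same \<open>h\<close> can be concatenated, and long loops close up cyclically. The
  word may be shorter than \<open>h\<close>, in which case the start of \<open>w @ h\<close> is meant.
\<close>
definition loop :: "('v \<Rightarrow> 'v \<Rightarrow> 'v \<Rightarrow> 'v \<Rightarrow> bool) \<Rightarrow> ('v \<times> 'v) list \<Rightarrow> ('v \<times> 'v) list \<Rightarrow> bool" where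
  "loop D h w \<longleftrightarrow> length h = 4 \<and> take 4 (w @ h) = h \<and> walk D (w @ h)"

lemma loop_append:
  assumes "loop D h u" "loop D h v"
  shows "loop D h (u @ v)"
proof -
  define y where "y = drop 4 (v @ h)"
  have h: "length h = 4" "take 4 (u @ h) = h" and vh: "v @ h = h @ y"
    using assms append_take_drop_id [of 4 "v @ h"] by (simp_all add: loop_def y_def)
  have "take 4 (u @ v @ h) = take 4 (u @ h)"
    unfolding vh using h(1) by simp
  moreover have "walk D (u @ h @ y)"
    unfolding walk_def
  proof (intro allI impI)
    fix i assume i: "i + 4 < length (u @ h @ y)"
    show "link D ((u @ h @ y) ! i) ((u @ h @ y) ! (i + 1)) ((u @ h @ y) ! (i + 2))
        ((u @ h @ y) ! (i + 3)) ((u @ h @ y) ! (i + 4))"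
    proof (cases "i < length u")
      case True
      then have "(u @ h @ y) ! (i + k) = (u @ h) ! (i + k)" if "k \<le> 4" for k
        using that h(1) by (auto simp: nth_append)
      from this [of 0] this [of 1] this [of 2] this [of 3] this [of 4] show ?thesis
        using assms(1) True h(1) by (simp add: loop_def walk_def)
    next
      case False
      then obtain j where j: "i = length u + j" using le_Suc_ex by (metis not_less)
      have "(u @ h @ y) ! (i + k) = (v @ h) ! (j + k)" for k
        unfolding vh j by (simp add: nth_append add.assoc)
      from this [of 0] this [of 1] this [of 2] this [of 3] this [of 4] show ?thesis
        using assms(2) i unfolding loop_def walk_def j vh by (simp add: add.assoc)
    qed
  qed
  ultimately show ?thesis
    using h vh by (simp add: loop_def)
qed

lemma loop_replicate:
  assumes "loop D h w"
  shows "loop D h (concat (replicate q w))"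
proof (induction q)
  case 0
  then show ?case using assms by (simp add: loop_def walk_short)
next
  case (Suc q)
  then show ?case using assms by (simp add: loop_append)
qed

lemma linked_if_loop:
  assumes "loop D h w" "length w = n" "n \<ge> 5"
  shows "linked D (\<lambda>i. w ! (i mod n))"
  unfolding linked_def
proof
  fix i
  define j where "j = i mod n"
  have "j < n" using assms(3) by (simp add: j_def)
  have h: "length h = 4" "take 4 (w @ h) = h" "walk D (w @ h)"
    using assms(1) by (simp_all add: loop_def)
  have shift: "(w @ h) ! (j + k) = w ! ((i + k) mod n)" if "k \<le> 4" for k
  proof -
    have mod: "(i + k) mod n = (j + k) mod n" by (simp add: j_def mod_simps)
    show ?thesis
    proof (cases "j + k < n")
      case True
      then show ?thesis using assms(2) mod by (simp add: nth_append)
    next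
      case False
      define m where "m = j + k - n"
      have m: "j + k = n + m" "m < 4" "m < n"
        using False that \<open>j < n\<close> assms(3) by (simp_all add: m_def)
      have "(w @ h) ! (n + m) = h ! m" using assms(2) by (simp add: nth_append)
      also have "\<dots> = take 4 (w @ h) ! m" using h(2) by simp
      also have "\<dots> = w ! m" using m assms(2) by (simp add: nth_append)
      finally show ?thesis using m mod by simp
    qed
  qed
  have "link D ((w @ h) ! j) ((w @ h) ! (j + 1)) ((w @ h) ! (j + 2))
      ((w @ h) ! (j + 3)) ((w @ h) ! (j + 4))"
    using h(1,3) \<open>j < n\<close> assms(2) unfolding walk_def by simp
  moreover have "(w @ h) ! j = w ! (i mod n)" "(w @ h) ! (j + 1) = w ! ((i + 1) mod n)"
    "(w @ h) ! (j + 2) = w ! ((i + 2) mod n)" "(w @ h) ! (j + 3) = w ! ((i + 3) mod n)"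
    "(w @ h) ! (j + 4) = w ! ((i + 4) mod n)"
    using shift [of 0] shift [of 1] shift [of 2] shift [of 3] shift [of 4] by simp_all
  ultimately show "link D (w ! (i mod n)) (w ! ((i + 1) mod n)) (w ! ((i + 2) mod n))
      (w ! ((i + 3) mod n)) (w ! ((i + 4) mod n))"
    by metis
qed

definition spread :: "('v \<times> 'v) list \<Rightarrow> nat \<Rightarrow> 'v" where
  "spread w v = (if even v then fst else snd) (w ! (v div 2))"

lemma columns_spread: "columns n (spread w) i = w ! (i mod n)"
  by (simp add: columns_def spread_def)

lemma sum_spread:
  fixes h :: "'v \<Rightarrow> nat"
  shows "(\<Sum>v<2 * length w. h (spread w v)) = (\<Sum>(x, y)\<leftarrow>w. h x + h y)"
  unfolding sum_over_vertices
  by (simp add: spread_def sum_list_sum_nth atLeast0LessThan case_prod_beta)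

lemma italian_domination_number_le:
  assumes "loop italian_at h w" "length w \<ge> 5"
  shows "italian_domination_number (petersen (length w) 2) \<le> (\<Sum>(x, y)\<leftarrow>w. x + y)"
proof -
  have "italian_dominating (petersen (length w) 2) (spread w)"
    using linked_if_loop [OF assms(1) refl assms(2)]
    by (simp add: italian_dominating_iff_linked [OF assms(2)] columns_spread [abs_def])
  then show ?thesis
    unfolding italian_domination_number_def
    using sum_spread [of "\<lambda>x. x" w] by (intro Least_le) auto
qed

lemma rainbow2_domination_number_le:
  assumes "loop rainbow_at h w" "length w \<ge> 5"
  shows "rainbow2_domination_number (petersen (length w) 2) \<le> (\<Sum>(x, y)\<leftarrow>w. card x + card y)"
proof -
  have "rainbow2_dominating (petersen (length w) 2) (spread w)"
    using linked_if_loop [OF assms(1) refl assms(2)]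
    by (simp add: rainbow2_dominating_iff_linked [OF assms(2)] columns_spread [abs_def])
  then show ?thesis
    unfolding rainbow2_domination_number_def
    using sum_spread [of card w] by (intro Least_le) auto
qed

text \<open>
  The extremal pattern found above: steps of length 5, and one step of length 3 if needed.
\<close>
lemma italian_upper_bound:
  assumes "(l, k) \<in> {(5, 4), (8, 7)}"
  shows "italian_domination_number (petersen (5 * q + l) 2) \<le> 4 * q + k"
proof -
  let ?b = "block @ [(0, 0)]"
  have b: "loop italian_at block ?b"
    by (simp add: loop_def walk_Cons walk_short block_def italian_at_def)
  have "loop italian_at block (?b @ take 3 block)"
    by (simp add: loop_def walk_Cons walk_short block_def italian_at_def)
  with b obtain t where t: "loop italian_at block t" "length t = l" "(\<Sum>(x, y)\<leftarrow>t. x + y) = k"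
    using assms that [of ?b] that [of "?b @ take 3 block"] by (auto simp: block_def)
  let ?w = "concat (replicate q ?b) @ t"
  have "length ?w = 5 * q + l" "(\<Sum>(x, y)\<leftarrow>?w. x + y) = 4 * q + k"
    using t by (induction q) (simp_all add: block_def)
  moreover have "loop italian_at block ?w"
    by (intro loop_append loop_replicate b t)
  ultimately show ?thesis
    using italian_domination_number_le [of block ?w] assms by auto
qed

text \<open>
  The ten words have minimal weight among the loops of their length at the block \<open>?h\<close>. The word
  \<open>?b\<close> consists of two steps of length 5, after which the hues are restored.
\<close>
lemma rainbow_upper_bound:
  assumes "(l, k) \<in> {(5, 5), (6, 6), (7, 7), (8, 8), (9, 8), (10, 8), (11, 10), (12, 11), (13, 11), (14, 12)}"
  shows "rainbow2_domination_number (petersen (10 * q + l) 2) \<le> 8 * q + k"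
proof -
  let ?h = "[({1}, {}), ({}, {2}), ({}, {2}), ({1}, {})] :: (nat set \<times> nat set) list"
  let ?h' = "[({2}, {}), ({}, {1}), ({}, {1}), ({2}, {})] :: (nat set \<times> nat set) list"
  let ?z = "[({}, {})] :: (nat set \<times> nat set) list"
  let ?b = "?h @ ?z @ ?h' @ ?z"
  let ?T = "{?h @ [({}, {2})],
    take 3 ?h @ take 3 ?h,
    ?h @ ?z @ [({2}, {1}), ({}, {1})],
    ?h @ ?z @ [({2}, {}), ({}, {1}), ({}, {1, 2})],
    ?h @ ?z @ ?h',
    ?b,
    ?h @ ?z @ ?h' @ [({}, {1}), ({}, {2})],
    ?b @ [({1}, {1}), ({}, {2})],
    ?b @ take 3 ?h,
    ?b @ ?h}"
  have loops: "loop rainbow_at ?h t" if "t \<in> ?T" for t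
    using that
    by (elim insertE emptyE) (simp_all add: loop_def walk_Cons walk_short rainbow_at_def insert_commute)
  have "\<exists>t\<in>?T. length t = l \<and> (\<Sum>(x, y)\<leftarrow>t. card x + card y) = k"
    using assms by (elim insertE emptyE) simp_all
  then obtain t where t: "loop rainbow_at ?h t" "length t = l" "(\<Sum>(x, y)\<leftarrow>t. card x + card y) = k"
    using loops by blast
  let ?w = "concat (replicate q ?b) @ t"
  have "length ?w = 10 * q + l" "(\<Sum>(x, y)\<leftarrow>?w. card x + card y) = 8 * q + k"
    using t by (induction q) simp_all
  moreover have "loop rainbow_at ?h ?w"
    by (intro loop_append loop_replicate loops t) simp
  ultimately show ?thesis
    using rainbow2_domination_number_le [of ?h ?w] assms by auto
qed

section \<open>The two domination numbers\<close>

lemma sum_columns: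
  fixes h :: "'v \<Rightarrow> nat"
  shows "(\<Sum>v<2 * n. h (f v)) = (\<Sum>i<n. h (fst (columns n f i)) + h (snd (columns n f i)))"
  by (simp add: sum_over_vertices columns_def)

lemma italian_number_excess:
  assumes "n \<ge> 5"
  obtains e where "5 * italian_domination_number (petersen n 2) = 4 * n + e" "e \<noteq> 1" "e \<noteq> 2"
proof -
  obtain f where f: "italian_dominating (petersen n 2) f"
      "italian_domination_number (petersen n 2) = (\<Sum>v<2 * n. f v)"
    unfolding italian_domination_number_def
    using LeastI_ex [of "\<lambda>w. \<exists>f. italian_dominating (petersen n 2) f \<and> w = (\<Sum>v\<in>pverts (petersen n 2). f v)"]
      italian_dominating_exists [of "petersen n 2"] by auto
  interpret italian_cycle n "columns n f"
    using assms f(1) by unfold_locales (simp_all add: italian_dominating_iff_linked columns_def)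
  have "italian_domination_number (petersen n 2) = weight"
    using sum_columns [of "\<lambda>x. x" f n] by (simp add: f(2) weight_def)
  then show ?thesis
    using that [of excess] excess_eq excess_not_1_2 by simp
qed

text \<open>
  Replacing every set by its cardinality turns a 2-rainbow dominating function into an Italian
  dominating function of the same weight, which yields the last inequality.
\<close>
lemma rainbow_number_excess:
  assumes "n \<ge> 5"
  obtains e where "5 * rainbow2_domination_number (petersen n 2) = 4 * n + e"
    and "n mod 10 = 5 \<Longrightarrow> e \<noteq> 0" "n mod 10 = 8 \<Longrightarrow> e \<noteq> 3"
    and "italian_domination_number (petersen n 2) \<le> rainbow2_domination_number (petersen n 2)"
proof -
  obtain g where g: "rainbow2_dominating (petersen n 2) g"
      "rainbow2_domination_number (petersen n 2) = (\<Sum>v<2 * n. card (g v))"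
    unfolding rainbow2_domination_number_def
    using LeastI_ex [of "\<lambda>w. \<exists>g. rainbow2_dominating (petersen n 2) g \<and> w = (\<Sum>v\<in>pverts (petersen n 2). card (g v))"]
      rainbow2_dominating_exists [of "petersen n 2"] by auto
  interpret rainbow_cycle n "columns n g"
    using assms g(1) by unfold_locales (simp_all add: rainbow2_dominating_iff_linked columns_def)
  have "rainbow2_domination_number (petersen n 2) = weight"
    unfolding g(2) weight_def using sum_columns [of card g n] by simp
  moreover have "italian_dominating (petersen n 2) (\<lambda>v. card (g v))"
  proof -
    have "columns n (\<lambda>v. card (g v)) = (\<lambda>i. map_prod card card (columns n g i))"
      by (simp add: columns_def fun_eq_iff)
    then show ?thesis
      using linked by (simp add: italian_dominating_iff_linked [OF assms])
  qed
  then have "italian_domination_number (petersen n 2) \<le> rainbow2_domination_number (petersen n 2)"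
    unfolding italian_domination_number_def g(2) by (intro Least_le) auto
  ultimately show ?thesis
    using that [of excess] excess_eq excess_not_0 excess_not_3 by simp
qed

theorem mainTheorem5:
  fixes n :: nat
  assumes "n \<ge> 5"
  shows "(n mod 10 \<in> {0, 1, 2, 3, 4, 6, 7, 9} \<longrightarrow>
            italian_domination_number (petersen n 2) = rainbow2_domination_number (petersen n 2)) \<and>
         (n mod 10 \<in> {5, 8} \<longrightarrow>
            int (italian_domination_number (petersen n 2)) =
              int (rainbow2_domination_number (petersen n 2)) - 1)"
proof -
  define i where "i = italian_domination_number (petersen n 2)"
  define r where "r = rainbow2_domination_number (petersen n 2)"
  obtain e where e: "5 * i = 4 * n + e" "e \<noteq> 1" "e \<noteq> 2"
    using italian_number_excess [OF assms] unfolding i_def by blast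
  obtain e' where e': "5 * r = 4 * n + e'" "n mod 10 = 5 \<longrightarrow> e' \<noteq> 0" "n mod 10 = 8 \<longrightarrow> e' \<noteq> 3" "i \<le> r"
    using rainbow_number_excess [OF assms] unfolding i_def r_def by blast
  \<comment> \<open>the remainders start at 5, the shortest length of a loop that is used\<close>
  define q where "q = (n - 5) div 10"
  define l where "l = (n - 5) mod 10 + 5"
  have n: "n = 10 * q + l" using assms by (simp add: q_def l_def)
  have r: "r \<le> 8 * q + k"
    if "(l, k) \<in> {(5, 5), (6, 6), (7, 7), (8, 8), (9, 8), (10, 8), (11, 10), (12, 11), (13, 11), (14, 12)}"
    for k
    using rainbow_upper_bound [OF that] by (simp add: r_def n)
  have i: "i \<le> 8 * q + k" if "(l, k) \<in> {(5, 4), (8, 7)}" for k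
    using italian_upper_bound [OF that, of "2 * q"] by (simp add: i_def n)
  have "(n - 5) mod 10 < 10" by simp
  then have "l \<ge> 5" "l \<le> 14"
    unfolding l_def by simp_all
  then have l: "l = 5 \<or> l = 6 \<or> l = 7 \<or> l = 8 \<or> l = 9 \<or> l = 10 \<or> l = 11 \<or> l = 12 \<or> l = 13 \<or> l = 14"
    by arith
  have mod: "n mod 10 = l mod 10" by (simp add: n)
  \<comment> \<open>subtracting the weight \<open>8 * q\<close> of the copies leaves two small numbers, squeezed between the
    bounds for \<open>n = l\<close>\<close>
  obtain x where x: "i = 8 * q + x"
    using e(1) n le_Suc_ex [of "8 * q" i] by auto
  obtain y where y: "r = 8 * q + y"
    using e'(1) n le_Suc_ex [of "8 * q" r] by auto
  have "5 * x = 4 * l + e" "5 * y = 4 * l + e'" "x \<le> y"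
    using e(1) e'(1,4) unfolding x y n by simp_all
  then have lower: "4 * l \<le> 5 * x" "5 * x \<noteq> 4 * l + 1" "5 * x \<noteq> 4 * l + 2" "4 * l \<le> 5 * y"
      "l mod 10 = 5 \<longrightarrow> 5 * y \<noteq> 4 * l" "l mod 10 = 8 \<longrightarrow> 5 * y \<noteq> 4 * l + 3" "x \<le> y"
    using e(2,3) e'(2,3) mod by auto
  have "if l mod 10 \<in> {5, 8} then y = x + 1 else x = y"
    using l
  proof (elim disjE)
    assume "l = 5"
    then show ?thesis using lower r [of 5] i [of 4] unfolding x y by (simp; arith)
  next
    assume "l = 6"
    then show ?thesis using lower r [of 6] unfolding y by (simp; arith)
  next
    assume "l = 7"
    then show ?thesis using lower r [of 7] unfolding y by (simp; arith)
  next
    assume "l = 8"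
    then show ?thesis using lower r [of 8] i [of 7] unfolding x y by (simp; arith)
  next
    assume "l = 9"
    then show ?thesis using lower r [of 8] unfolding y by (simp; arith)
  next
    assume "l = 10"
    then show ?thesis using lower r [of 8] unfolding y by (simp; arith)
  next
    assume "l = 11"
    then show ?thesis using lower r [of 10] unfolding y by (simp; arith)
  next
    assume "l = 12"
    then show ?thesis using lower r [of 11] unfolding y by (simp; arith)
  next
    assume "l = 13"
    then show ?thesis using lower r [of 11] unfolding y by (simp; arith)
  next
    assume "l = 14"
    then show ?thesis using lower r [of 12] unfolding y by (simp; arith)
  qed
  then show ?thesis
    unfolding i_def [symmetric] r_def [symmetric] mod x y by (auto split: if_splits)
qed

end
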